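(* For all integers $p,q>0$, the class $\mathcal{F}^{p,q}$ of all graphs that are both $F_S^{p,q}$-free and $F_K^{p,q}$-free has the clique-stable set separation property.
   Context: All graphs are finite and simple. A clique is a set of pairwise adjacent vertices; a stable set is a set of pairwise non-adjacent vertices. For disjoint vertex sets $X,Y$: $X$ is complete to $Y$ if every vertex of $X$ is adjacent to every vertex of $Y$; $X$ and $Y$ are matched if every vertex of $X$ has exactly one neighbor in $Y$ and every vertex of $Y$ has exactly one neighbor in $X$. A graph $G$ is $H$-free if no induced subgraph of $G$ is isomorphic to $H$. The graph $F_S^{p,q}$ has vertex set $K\cup S_1\cup S_2\cup S_3$ (pairwise disjoint), where $K$ is a clique, $S_1,S_2,S_3$ are stable sets, $|K|=|S_1|=p$ and $K$ and $S_1$ are matched, $|S_2|=|S_3|=q$ and $S_2$ and $S_3$ are matched, $K$ is complete to $S_2$, and there are no other edges. The graph $F_K^{p,q}$ is obtained from $F_S^{p,q}$ by making all pairs of vertices of $S_3$ adjacent. A class $\mathcal{C}$ of graphs closed under taking induced subgraphs has the clique-stable set separation property if there exists $c\in\mathbb{N}$ such that for every $G\in\mathcal{C}$ there is a collection $\mathcal{P}$ of partitions $(X,Y)$ of $V(G)$ with $|\mathcal{P}|\le |V(G)|^c$ such that for every clique $K$ and stable set $S$ of $G$ with $K\cap S=\emptyset$ there is $(X,Y)\in\mathcal{P}$ with $K\subseteq X$ and $S\subseteq Y$.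
   Formalization: The bound |P| ≤ |V(G)|^c is required only for graphs with at least two vertices, since it fails as stated for the one-vertex graph (two partitions are needed but 1^c = 1) and for the null graph when c > 0. *)

theory Defs
  imports "Graph_Theory.Graph_Theory"
begin

text \<open>
  A finite simple graph is a \<^locale>\<open>pair_graph\<close>: a finite set of vertices together with a finite,
  symmetric, irreflexive adjacency relation \<^const>\<open>parcs\<close>. Induced subgraphs and isomorphism are
  \<^const>\<open>induced_subgraph\<close> and \<^const>\<open>digraph_iso\<close>.
\<close>

definition clique :: "'a pair_pre_digraph \<Rightarrow> 'a set \<Rightarrow> bool" where
  "clique G X \<longleftrightarrow> X \<subseteq> pverts G \<and> (\<forall>u\<in>X. \<forall>v\<in>X. u \<noteq> v \<longrightarrow> (u, v) \<in> parcs G)"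

definition stable_set :: "'a pair_pre_digraph \<Rightarrow> 'a set \<Rightarrow> bool" where
  "stable_set G X \<longleftrightarrow> X \<subseteq> pverts G \<and> (\<forall>u\<in>X. \<forall>v\<in>X. (u, v) \<notin> parcs G)"

definition complete_to :: "'a pair_pre_digraph \<Rightarrow> 'a set \<Rightarrow> 'a set \<Rightarrow> bool" where
  "complete_to G X Y \<longleftrightarrow> (\<forall>u\<in>X. \<forall>v\<in>Y. (u, v) \<in> parcs G)"

definition anticomplete_to :: "'a pair_pre_digraph \<Rightarrow> 'a set \<Rightarrow> 'a set \<Rightarrow> bool" where
  "anticomplete_to G X Y \<longleftrightarrow> (\<forall>u\<in>X. \<forall>v\<in>Y. (u, v) \<notin> parcs G)"

definition matched :: "'a pair_pre_digraph \<Rightarrow> 'a set \<Rightarrow> 'a set \<Rightarrow> bool" where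
  "matched G X Y \<longleftrightarrow>
    (\<forall>u\<in>X. \<exists>!v. v \<in> Y \<and> (u, v) \<in> parcs G) \<and> (\<forall>v\<in>Y. \<exists>!u. u \<in> X \<and> (v, u) \<in> parcs G)"

definition free_of :: "'b pair_pre_digraph \<Rightarrow> 'a pair_pre_digraph \<Rightarrow> bool" where
  "free_of H G \<longleftrightarrow>
    \<not> (\<exists>G'. induced_subgraph (with_proj G') (with_proj G) \<and> digraph_iso (with_proj G') (with_proj H))"

datatype fvertex = VK nat | VS1 nat | VS2 nat | VS3 nat

definition fverts :: "nat \<Rightarrow> nat \<Rightarrow> fvertex set" where
  "fverts p q = VK ` {..<p} \<union> VS1 ` {..<p} \<union> VS2 ` {..<q} \<union> VS3 ` {..<q}"

text \<open>
  Each edge is listed in one direction between the four parts; the converse makes the relation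
  symmetric. Matched vertices are those with equal index.
\<close>

definition FS_edges :: "nat \<Rightarrow> nat \<Rightarrow> fvertex rel" where
  "FS_edges p q =
    {(VK i, VK j) | i j. i < p \<and> j < p \<and> i \<noteq> j} \<union>
    {(VK i, VS1 i) | i. i < p} \<union>
    {(VS2 i, VS3 i) | i. i < q} \<union>
    {(VK i, VS2 j) | i j. i < p \<and> j < q}"

definition F_S :: "nat \<Rightarrow> nat \<Rightarrow> fvertex pair_pre_digraph" where
  "F_S p q = \<lparr> pverts = fverts p q, parcs = FS_edges p q \<union> (FS_edges p q)\<inverse> \<rparr>"

definition F_K :: "nat \<Rightarrow> nat \<Rightarrow> fvertex pair_pre_digraph" where
  "F_K p q = \<lparr> pverts = fverts p q,
     parcs = parcs (F_S p q) \<union> {(VS3 i, VS3 j) | i j. i < q \<and> j < q \<and> i \<noteq> j} \<rparr>"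

text \<open>
  The next lemmas check the two concrete graphs against their description: ``no other edges'' means
  that every pair of parts not mentioned is anticomplete.
\<close>

lemma pair_graph_F_S: "pair_graph (F_S p q)"
proof -
  have sub: "parcs (F_S p q) \<subseteq> fverts p q \<times> fverts p q"
    by (auto simp: F_S_def FS_edges_def fverts_def)
  have fin: "finite (fverts p q)" by (simp add: fverts_def)
  show ?thesis
  proof unfold_locales
    show "finite (parcs (F_S p q))" using sub fin by (meson finite_SigmaI finite_subset)
    show "finite (pverts (F_S p q))" using fin by (simp add: F_S_def)
    show "symmetric (with_proj (F_S p q))"
      by (auto simp: symmetric_def F_S_def intro!: symI)
  qed (use sub in \<open>auto simp: F_S_def FS_edges_def\<close>)
qed

lemma pair_graph_F_K: "pair_graph (F_K p q)"
proof -
  have sub: "parcs (F_K p q) \<subseteq> fverts p q \<times> fverts p q"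
    by (auto simp: F_K_def F_S_def FS_edges_def fverts_def)
  have fin: "finite (fverts p q)" by (simp add: fverts_def)
  show ?thesis
  proof unfold_locales
    show "finite (parcs (F_K p q))" using sub fin by (meson finite_SigmaI finite_subset)
    show "finite (pverts (F_K p q))" using fin by (simp add: F_K_def)
    show "symmetric (with_proj (F_K p q))"
      by (auto simp: symmetric_def F_K_def F_S_def intro!: symI)
  qed (use sub in \<open>auto simp: F_K_def F_S_def FS_edges_def\<close>)
qed

lemma F_S_structure:
  fixes p q :: nat
  defines "K \<equiv> VK ` {..<p}" and "S1 \<equiv> VS1 ` {..<p}"
    and "S2 \<equiv> VS2 ` {..<q}" and "S3 \<equiv> VS3 ` {..<q}"
  shows "pverts (F_S p q) = K \<union> S1 \<union> S2 \<union> S3"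
    and "K \<inter> S1 = {}" "K \<inter> S2 = {}" "K \<inter> S3 = {}" "S1 \<inter> S2 = {}" "S1 \<inter> S3 = {}" "S2 \<inter> S3 = {}"
    and "card K = p" "card S1 = p" "card S2 = q" "card S3 = q"
    and "clique (F_S p q) K"
    and "stable_set (F_S p q) S1" "stable_set (F_S p q) S2" "stable_set (F_S p q) S3"
    and "matched (F_S p q) K S1" "matched (F_S p q) S2 S3" "complete_to (F_S p q) K S2"
    and "anticomplete_to (F_S p q) K S3" "anticomplete_to (F_S p q) S1 S2"
      "anticomplete_to (F_S p q) S1 S3"
  unfolding K_def S1_def S2_def S3_def
  by (auto simp: F_S_def FS_edges_def fverts_def clique_def stable_set_def matched_def
      complete_to_def anticomplete_to_def card_image inj_on_def)

lemma F_K_structure: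
  "pverts (F_K p q) = pverts (F_S p q)"
  "parcs (F_K p q) = parcs (F_S p q) \<union>
    {(u, v). u \<in> VS3 ` {..<q} \<and> v \<in> VS3 ` {..<q} \<and> u \<noteq> v}"
  by (auto simp: F_K_def F_S_def)

definition F_class :: "nat \<Rightarrow> nat \<Rightarrow> 'a pair_pre_digraph set" where
  "F_class p q = {G. pair_graph G \<and> free_of (F_S p q) G \<and> free_of (F_K p q) G}"

definition hereditary :: "'a pair_pre_digraph set \<Rightarrow> bool" where
  "hereditary C \<longleftrightarrow>
    (\<forall>G\<in>C. \<forall>H. induced_subgraph (with_proj H) (with_proj G) \<longrightarrow> H \<in> C)"

text \<open>
  A partition \<open>(X, Y)\<close> may have an empty side. Graphs with fewer than two vertices are exempt from
  the bound: the null graph needs one partition (for \<open>K = S = {}\<close>), but \<open>0 ^ c = 0\<close> for \<open>c > 0\<close>;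
  a one-vertex graph needs two (for \<open>K = {v}, S = {}\<close> and \<open>K = {}, S = {v}\<close>), but \<open>1 ^ c = 1\<close>.
\<close>

definition clique_stable_separation :: "'a pair_pre_digraph set \<Rightarrow> bool" where
  "clique_stable_separation C \<longleftrightarrow> hereditary C \<and>
    (\<exists>c::nat. \<forall>G\<in>C. card (pverts G) \<ge> 2 \<longrightarrow>
      (\<exists>P. finite P \<and> card P \<le> card (pverts G) ^ c \<and>
        (\<forall>(X, Y)\<in>P. X \<union> Y = pverts G \<and> X \<inter> Y = {}) \<and>
        (\<forall>K S. clique G K \<and> stable_set G S \<and> K \<inter> S = {} \<longrightarrow>
          (\<exists>(X, Y)\<in>P. K \<subseteq> X \<and> S \<subseteq> Y))))"

end

theory Submission
  imports Defs "HOL-Library.Ramsey"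
begin

text \<open>
  Let \<open>K\<close> be a clique and \<open>S\<close> a disjoint stable set. If some \<open>k \<in> K\<close> has no neighbour in \<open>S\<close>, the
  closed neighbourhood of \<open>k\<close> separates them. Otherwise take \<open>S0 \<subseteq> S\<close> minimal with \<open>K \<subseteq> N(S0)\<close>; if
  \<open>S0\<close> is small, \<open>N(S0)\<close> separates. If not, choose \<open>S1 \<subseteq> S0\<close> with \<open>|S1| = p\<close> and let \<open>K'\<close> consist of one
  private neighbour in \<open>K\<close> of each vertex of \<open>S1\<close>, so that \<open>K'\<close> and \<open>S1\<close> are matched. Let \<open>B\<close> be the set
  of vertices with no neighbour in \<open>K' \<union> S1\<close>, let \<open>T\<close> be the set of vertices of \<open>S\<close> complete to \<open>K'\<close>, and
  take \<open>S2 \<subseteq> T\<close> minimal with \<open>N(S2) \<inter> B = N(T) \<inter> B\<close>. Private neighbours match \<open>S2\<close> into \<open>B\<close>, so by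
  Ramsey's theorem a large \<open>S2\<close> would yield one of the two excluded graphs. Thus \<open>K'\<close>, \<open>S1\<close>, \<open>S2\<close> all
  have bounded size, and they determine a separation: a vertex of \<open>K - K'\<close> without neighbours in \<open>S1\<close>
  has a neighbour in \<open>S0 - S1 \<subseteq> B - N(S2)\<close>, whereas by the choice of \<open>S2\<close> no vertex of \<open>T\<close> has a
  neighbour in \<open>B - N(S2)\<close>.
\<close>

section \<open>Induced subgraphs and heredity\<close>

lemma induced_subgraph_pair_iff:
  assumes "pair_wf_digraph G"
  shows "induced_subgraph (with_proj H) (with_proj G) \<longleftrightarrow>
    pverts H \<subseteq> pverts G \<and> parcs H = {(u, v) \<in> parcs G. u \<in> pverts H \<and> v \<in> pverts H}"
proof -
  \<comment> \<open>The arc condition alone puts both ends of every arc of \<open>H\<close> into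
    \<open>H\<close>, which supplies the well-formedness that \<open>induced_subgraph\<close> asks
    of \<open>H\<close>.\<close>
  have "pair_wf_digraph H"
    if "parcs H = {(u, v) \<in> parcs G. u \<in> pverts H \<and> v \<in> pverts H}"
    using that by (auto simp: pair_wf_digraph_def)
  then show ?thesis
    using assms by (auto simp: induced_subgraph_def subgraph_def wf_digraph_wp_iff)
qed

lemma pair_graph_induced_subgraph:
  assumes "pair_graph G" "induced_subgraph (with_proj H) (with_proj G)"
  shows "pair_graph H"
proof -
  interpret pair_graph G by fact
  have H: "pverts H \<subseteq> pverts G" "parcs H = {(u, v) \<in> parcs G. u \<in> pverts H \<and> v \<in> pverts H}"
    using assms(2) by (auto simp: induced_subgraph_pair_iff[OF pair_wf_digraph_axioms])
  show ?thesis
  proof unfold_locales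
    show "finite (pverts H)" using H(1) finite_verts by (rule finite_subset)
    show "finite (parcs H)" unfolding H(2) by (rule finite_subset[of _ "parcs G"]) auto
    show "symmetric (with_proj H)"
      using arcs_symmetric H(2) by (auto simp: symmetric_def intro!: symI)
  qed (use H(2) no_loops in auto)
qed

lemma hereditary_F_class: "hereditary (F_class p q)"
  unfolding hereditary_def
proof (intro ballI allI impI)
  fix G H :: "'a pair_pre_digraph"
  assume G: "G \<in> F_class p q" and HG: "induced_subgraph (with_proj H) (with_proj G)"
  then have pg: "pair_graph G" "pair_graph H"
    by (auto simp: F_class_def intro: pair_graph_induced_subgraph)
  then have wf: "pair_wf_digraph G" "pair_wf_digraph H"
    by (simp_all add: pair_graph_def pair_digraph_def pair_fin_digraph_def)
  \<comment> \<open>Being induced is transitive, so a forbidden induced subgraph of \<open>H\<close>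
    would already occur in \<open>G\<close>.\<close>
  have "induced_subgraph (with_proj G') (with_proj G)"
    if "induced_subgraph (with_proj G') (with_proj H)" for G'
    using that HG unfolding wf[THEN induced_subgraph_pair_iff] by auto
  then show "H \<in> F_class p q"
    using G pg unfolding F_class_def free_of_def by blast
qed

section \<open>Recognising the forbidden graphs by adjacencies\<close>

lemma not_free_of_embedding:
  assumes G: "pair_wf_digraph G" and H: "pair_wf_digraph H"
    and inj: "inj_on f (pverts H)" and sub: "f ` pverts H \<subseteq> pverts G"
    and adj: "\<And>u v. u \<in> pverts H \<Longrightarrow> v \<in> pverts H \<Longrightarrow> (f u, f v) \<in> parcs G \<longleftrightarrow> (u, v) \<in> parcs H"
  shows "\<not> free_of H G"
proof -
  interpret H: pair_wf_digraph H by fact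
  let ?h = "\<lparr>iso_verts = f, iso_arcs = map_prod f f, iso_head = snd, iso_tail = fst\<rparr>"
  let ?G' = "\<lparr>pverts = f ` pverts H, parcs = map_prod f f ` parcs H\<rparr>"
  have arcs: "parcs H \<subseteq> pverts H \<times> pverts H"
    using H.in_arcsD1 H.in_arcsD2 by auto
  have "inj_on (map_prod f f) (parcs H)"
    using map_prod_inj_on[OF inj inj] arcs by (rule inj_on_subset)
  then have iso: "H.digraph_isomorphism ?h"
    using inj H by (auto simp: H.digraph_isomorphism_def wf_digraph_wp_iff)
  have app: "app_iso ?h (with_proj H) = with_proj ?G'"
    by (simp add: app_iso_def with_proj_def)
  \<comment> \<open>\<open>?h\<close> maps \<open>H\<close> onto its copy \<open>?G'\<close> inside
    \<open>G\<close>, whereas the required isomorphism runs from the copy to \<open>H\<close>; the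
    witness is the inverse of \<open>?h\<close>.\<close>
  have "digraph_iso (with_proj ?G') (with_proj H)"
    unfolding digraph_iso_def
    using H.digraph_isomorphism_invI[OF iso] H.app_iso_inv[OF iso] unfolding app by metis
  moreover have "parcs ?G' = {(u, v) \<in> parcs G. u \<in> pverts ?G' \<and> v \<in> pverts ?G'}"
    using adj arcs by (force simp: image_iff)
  then have "induced_subgraph (with_proj ?G') (with_proj G)"
    using sub by (simp add: induced_subgraph_pair_iff[OF G])
  ultimately show ?thesis unfolding free_of_def by blast
qed

text \<open>The families \<open>k\<close>, \<open>s\<close>, \<open>t\<close>, \<open>b\<close>
  stand for the parts \<open>VK\<close>, \<open>VS1\<close>, \<open>VS2\<close>, \<open>VS3\<close>.
  Matching indices embeds \<open>F_K p q\<close> under the first alternative of \<open>bb\<close>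
  and \<open>F_S p q\<close> under the second; the adjacencies themselves force this map to be
  injective.\<close>

lemma F_class_no_pattern:
  assumes G: "G \<in> F_class p q" and p: "p > 0"
    and verts: "\<And>i. i < p \<Longrightarrow> k i \<in> pverts G" "\<And>i. i < p \<Longrightarrow> s i \<in> pverts G"
      "\<And>i. i < q \<Longrightarrow> t i \<in> pverts G" "\<And>i. i < q \<Longrightarrow> b i \<in> pverts G"
    and kk: "\<And>i j. i < p \<Longrightarrow> j < p \<Longrightarrow> (k i, k j) \<in> parcs G \<longleftrightarrow> i \<noteq> j"
    and ss: "\<And>i j. i < p \<Longrightarrow> j < p \<Longrightarrow> (s i, s j) \<notin> parcs G"
    and ks: "\<And>i j. i < p \<Longrightarrow> j < p \<Longrightarrow> (k i, s j) \<in> parcs G \<longleftrightarrow> i = j"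
    and kt: "\<And>i j. i < p \<Longrightarrow> j < q \<Longrightarrow> (k i, t j) \<in> parcs G"
    and kb: "\<And>i j. i < p \<Longrightarrow> j < q \<Longrightarrow> (k i, b j) \<notin> parcs G"
    and st: "\<And>i j. i < p \<Longrightarrow> j < q \<Longrightarrow> (s i, t j) \<notin> parcs G"
    and sb: "\<And>i j. i < p \<Longrightarrow> j < q \<Longrightarrow> (s i, b j) \<notin> parcs G"
    and tt: "\<And>i j. i < q \<Longrightarrow> j < q \<Longrightarrow> (t i, t j) \<notin> parcs G"
    and tb: "\<And>i j. i < q \<Longrightarrow> j < q \<Longrightarrow> (t i, b j) \<in> parcs G \<longleftrightarrow> i = j"
    and bb: "(\<forall>i<q. \<forall>j<q. i \<noteq> j \<longrightarrow> (b i, b j) \<in> parcs G) \<or>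
      (\<forall>i<q. \<forall>j<q. i \<noteq> j \<longrightarrow> (b i, b j) \<notin> parcs G)"
  shows False
proof -
  have free: "pair_graph G" "free_of (F_S p q) G" "free_of (F_K p q) G"
    using G by (auto simp: F_class_def)
  interpret pair_graph G by fact
  have sym: "(u, v) \<in> parcs G \<longleftrightarrow> (v, u) \<in> parcs G" for u v
    using arcs_symmetric by blast
  have irr: "(u, u) \<notin> parcs G" for u
    using no_loops by fastforce
  \<comment> \<open>As rewrite rules, these instances of symmetry turn pairs between different parts
    into the orientation in which the hypotheses are stated.\<close>
  note flip = sym[of "s _" "k _"] sym[of "t _" "k _"] sym[of "b _" "k _"] sym[of "t _" "s _"]
    sym[of "b _" "s _"] sym[of "b _" "t _"]
  define f where "f = (\<lambda>x. case x of VK i \<Rightarrow> k i | VS1 i \<Rightarrow> s i | VS2 i \<Rightarrow> t i | VS3 i \<Rightarrow> b i)"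
  have f: "f (VK i) = k i" "f (VS1 i) = s i" "f (VS2 i) = t i" "f (VS3 i) = b i" for i
    by (simp_all add: f_def)
  \<comment> \<open>Two vertices are distinct when they are adjacent or when some third vertex is
    adjacent to exactly one of them.\<close>
  have eqs: "k i = k j \<Longrightarrow> i < p \<Longrightarrow> j < p \<Longrightarrow> i = j"
      "s i = s j \<Longrightarrow> i < p \<Longrightarrow> j < p \<Longrightarrow> i = j"
      "t i = t j \<Longrightarrow> i < q \<Longrightarrow> j < q \<Longrightarrow> i = j"
      "b i = b j \<Longrightarrow> i < q \<Longrightarrow> j < q \<Longrightarrow> i = j"
      "i < p \<Longrightarrow> j < p \<Longrightarrow> k i \<noteq> s j" "i < p \<Longrightarrow> j < q \<Longrightarrow> k i \<noteq> t j" "i < p \<Longrightarrow> j < q \<Longrightarrow> s i \<noteq> t j"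
      "i < p \<Longrightarrow> j < q \<Longrightarrow> s i \<noteq> b j" "i < q \<Longrightarrow> j < q \<Longrightarrow> t i \<noteq> b j" for i j
    using kk ss ks kt kb st sb tt tb irr p by metis+
  have kb': "k i \<noteq> b j" if "i < p" "j < q" for i j
    using ks[of i i] sb[of i j] that sym by metis
  have inj: "inj_on f (fverts p q)"
    unfolding inj_on_def fverts_def by (auto simp: f eqs kb' eqs(5-)[symmetric] kb'[symmetric] dest: eqs(1-4))
  have sub: "f ` fverts p q \<subseteq> pverts G"
    using verts by (auto simp: fverts_def f)
  note pat = kk ss ks kt kb st sb tt tb flip f irr
  from bb show False
  proof
    assume B: "\<forall>i<q. \<forall>j<q. i \<noteq> j \<longrightarrow> (b i, b j) \<in> parcs G"
    have "(f u, f v) \<in> parcs G \<longleftrightarrow> (u, v) \<in> parcs (F_K p q)"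
      if "u \<in> fverts p q" "v \<in> fverts p q" for u v
      using that B unfolding fverts_def
      by (auto simp: pat F_K_def F_S_def FS_edges_def)
    then have "\<not> free_of (F_K p q) G"
      using inj sub pair_graph_F_K[of p q]
      by (intro not_free_of_embedding[where f = f] pair_wf_digraph_axioms)
        (auto simp: F_K_def pair_graph_def pair_digraph_def pair_fin_digraph_def)
    with free show False by simp
  next
    assume B: "\<forall>i<q. \<forall>j<q. i \<noteq> j \<longrightarrow> (b i, b j) \<notin> parcs G"
    have B': "(b i, b j) \<notin> parcs G" if "i < q" "j < q" for i j
      using B that irr by (cases "i = j") auto
    have "(f u, f v) \<in> parcs G \<longleftrightarrow> (u, v) \<in> parcs (F_S p q)"
      if "u \<in> fverts p q" "v \<in> fverts p q" for u v
      using that unfolding fverts_def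
      by (auto simp: pat B' F_S_def FS_edges_def)
    then have "\<not> free_of (F_S p q) G"
      using inj sub pair_graph_F_S[of p q]
      by (intro not_free_of_embedding[where f = f] pair_wf_digraph_axioms)
        (auto simp: F_S_def pair_graph_def pair_digraph_def pair_fin_digraph_def)
    with free show False by simp
  qed
qed

section \<open>Ramsey's theorem and irredundant covers\<close>

lemma ramsey_symp:
  "\<exists>r. \<forall>(A :: 'a set) Q. symp Q \<longrightarrow> finite A \<longrightarrow> r \<le> card A \<longrightarrow>
    (\<exists>R\<subseteq>A. card R = q \<and> ((\<forall>u\<in>R. \<forall>v\<in>R. u \<noteq> v \<longrightarrow> Q u v) \<or> (\<forall>u\<in>R. \<forall>v\<in>R. u \<noteq> v \<longrightarrow> \<not> Q u v)))"
proof -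
  obtain r where r: "\<And>(A :: 'a set) E. finite A \<Longrightarrow> r \<le> card A \<Longrightarrow>
      \<exists>R\<subseteq>A. card R = q \<and> Ramsey.clique R E \<or> card R = q \<and> indep R E"
    using ramsey2[of q q] by meson
  show ?thesis
  proof (rule exI[of _ r], intro allI impI)
    fix A :: "'a set" and Q :: "'a \<Rightarrow> 'a \<Rightarrow> bool"
    assume Q: "symp Q" and A: "finite A" "r \<le> card A"
    \<comment> \<open>Edges are doubletons here, and symmetry of \<open>Q\<close> ensures that
      \<open>Q\<close> can be read back from \<open>E\<close>.\<close>
    define E where "E = {{u, v} | u v. Q u v}"
    have E: "{u, v} \<in> E \<longleftrightarrow> Q u v" for u v
      using Q by (auto simp: E_def doubleton_eq_iff dest: sympD)
    obtain R where "R \<subseteq> A" "card R = q" "Ramsey.clique R E \<or> indep R E"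
      using r[OF A, of E] by metis
    then show "\<exists>R\<subseteq>A. card R = q \<and> ((\<forall>u\<in>R. \<forall>v\<in>R. u \<noteq> v \<longrightarrow> Q u v) \<or> (\<forall>u\<in>R. \<forall>v\<in>R. u \<noteq> v \<longrightarrow> \<not> Q u v))"
      unfolding Ramsey.clique_def indep_def E by (intro exI[of _ R]) simp
  qed
qed

lemma irredundant_subcover:
  assumes "finite S"
  shows "\<exists>S0\<subseteq>S. (\<Union>s\<in>S0. N s) = (\<Union>s\<in>S. N s) \<and> (\<forall>s\<in>S0. \<exists>x\<in>N s. \<forall>s'\<in>S0. x \<in> N s' \<longrightarrow> s' = s)"
  using assms
proof (induction S rule: finite_psubset_induct)
  case (psubset S)
  show ?case
  proof (cases "\<forall>s\<in>S. \<exists>x\<in>N s. \<forall>s'\<in>S. x \<in> N s' \<longrightarrow> s' = s")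
    case True
    then show ?thesis by blast
  next
    case False
    then obtain s where s: "s \<in> S" "\<And>x. x \<in> N s \<Longrightarrow> \<exists>s'\<in>S. x \<in> N s' \<and> s' \<noteq> s"
      by blast
    then have eq: "(\<Union>s\<in>S - {s}. N s) = (\<Union>s\<in>S. N s)" by blast
    have less: "S - {s} \<subset> S" using s(1) by blast
    obtain S0 where "S0 \<subseteq> S - {s}" "(\<Union>s\<in>S0. N s) = (\<Union>s\<in>S. N s)"
      "\<forall>s\<in>S0. \<exists>x\<in>N s. \<forall>s'\<in>S0. x \<in> N s' \<longrightarrow> s' = s"
      using psubset.IH[OF less] unfolding eq by (elim exE conjE)
    then show ?thesis by (intro exI[of _ S0]) auto
  qed
qed

section \<open>Separating a clique from a stable set\<close>

definition nbhd :: "'a pair_pre_digraph \<Rightarrow> 'a set \<Rightarrow> 'a set" where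
  "nbhd G T = {v \<in> pverts G. \<exists>t\<in>T. (v, t) \<in> parcs G}"

text \<open>The set difference is the \<open>B - N(S2)\<close> of the overview. \<open>K'\<close> is
  added by hand, because in a loopless graph none of its vertices is adjacent to all of
  \<open>K'\<close>.\<close>

definition pattern_side :: "'a pair_pre_digraph \<Rightarrow> 'a set \<Rightarrow> 'a set \<Rightarrow> 'a set \<Rightarrow> 'a set" where
  "pattern_side G K' S1 S2 = K' \<union> {v \<in> pverts G. (\<forall>k\<in>K'. (v, k) \<in> parcs G) \<and>
     (v \<in> nbhd G S1 \<or> v \<in> nbhd G (pverts G - nbhd G K' - nbhd G S1 - nbhd G S2))}"

text \<open>Each outcome describes a separating side by boundedly many vertices, which is what makes
  the sides countable later. The Ramsey number enters as a hypothesis so that one \<open>r\<close>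
  serves all graphs of the class.\<close>

lemma F_class_separating_side:
  fixes G :: "'a pair_pre_digraph"
  assumes G: "G \<in> F_class p q" and p: "p > 0"
    and r: "\<And>(A :: 'a set) Q. symp Q \<Longrightarrow> finite A \<Longrightarrow> r \<le> card A \<Longrightarrow>
      \<exists>R\<subseteq>A. card R = q \<and> ((\<forall>u\<in>R. \<forall>v\<in>R. u \<noteq> v \<longrightarrow> Q u v) \<or> (\<forall>u\<in>R. \<forall>v\<in>R. u \<noteq> v \<longrightarrow> \<not> Q u v))"
    and K: "Defs.clique G K" and S: "stable_set G S" and disj: "K \<inter> S = {}"
  obtains (dominating_vertex) k where "k \<in> pverts G"
      "K \<subseteq> insert k (nbhd G {k})" "S \<inter> insert k (nbhd G {k}) = {}"
    | (small_cover) T where "T \<subseteq> pverts G" "card T \<le> p" "K \<subseteq> nbhd G T" "S \<inter> nbhd G T = {}"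
    | (pattern) K' S1 S2 where "K' \<subseteq> pverts G" "S1 \<subseteq> pverts G" "S2 \<subseteq> pverts G"
      "card K' \<le> p" "card S1 \<le> p" "card S2 \<le> r"
      "K \<subseteq> pattern_side G K' S1 S2" "S \<inter> pattern_side G K' S1 S2 = {}"
proof -
  have "pair_graph G" using G by (simp add: F_class_def)
  then interpret pair_graph G .
  have sym: "(u, v) \<in> parcs G \<Longrightarrow> (v, u) \<in> parcs G" for u v
    using arcs_symmetric by blast
  have irr: "(u, u) \<notin> parcs G" for u
    using no_loops by fastforce
  have KV: "K \<subseteq> pverts G" and Kadj: "\<And>u v. u \<in> K \<Longrightarrow> v \<in> K \<Longrightarrow> u \<noteq> v \<Longrightarrow> (u, v) \<in> parcs G"
    using K by (auto simp: Defs.clique_def)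
  have SV: "S \<subseteq> pverts G" and Sadj: "\<And>u v. u \<in> S \<Longrightarrow> v \<in> S \<Longrightarrow> (u, v) \<notin> parcs G"
    using S by (auto simp: stable_set_def)
  have fin: "finite S" using SV finite_verts by (rule finite_subset)
  show thesis
  proof (cases "\<exists>k\<in>K. \<forall>s\<in>S. (k, s) \<notin> parcs G")
    case True
    then obtain k where k: "k \<in> K" "\<And>s. s \<in> S \<Longrightarrow> (k, s) \<notin> parcs G" by blast
    show thesis
    proof (rule dominating_vertex[of k])
      show "k \<in> pverts G" using k(1) KV by blast
      show "K \<subseteq> insert k (nbhd G {k})" using KV Kadj k(1) by (auto simp: nbhd_def)
      show "S \<inter> insert k (nbhd G {k}) = {}" using k disj sym by (auto simp: nbhd_def)
    qed
  next
    case False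
    \<comment> \<open>Cutting neighbourhoods down to \<open>K\<close> makes the private neighbours
      lie in \<open>K\<close>, hence form a clique.\<close>
    define N where "N s = {k \<in> K. (k, s) \<in> parcs G}" for s
    obtain S0 where S0: "S0 \<subseteq> S" "(\<Union>s\<in>S0. N s) = (\<Union>s\<in>S. N s)"
      and priv: "\<forall>s\<in>S0. \<exists>x\<in>N s. \<forall>s'\<in>S0. x \<in> N s' \<longrightarrow> s' = s"
      using irredundant_subcover[OF fin, of N] by blast
    obtain \<kappa> where \<kappa>: "\<And>s. s \<in> S0 \<Longrightarrow> \<kappa> s \<in> N s" "\<And>s s'. s \<in> S0 \<Longrightarrow> s' \<in> S0 \<Longrightarrow> \<kappa> s \<in> N s' \<Longrightarrow> s' = s"
      using priv by metis
    have cover: "\<exists>s\<in>S0. (k, s) \<in> parcs G" if "k \<in> K" for k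
    proof -
      have "k \<in> (\<Union>s\<in>S. N s)" using that False by (auto simp: N_def)
      then show ?thesis unfolding S0(2)[symmetric] by (auto simp: N_def)
    qed
    show thesis
    proof (cases "card S0 \<le> p")
      case True
      show thesis
      proof (rule small_cover[of S0])
        show "S0 \<subseteq> pverts G" using S0(1) SV by (rule order.trans)
        show "K \<subseteq> nbhd G S0" using cover KV by (auto simp: nbhd_def)
        show "S \<inter> nbhd G S0 = {}" using Sadj S0(1) by (auto simp: nbhd_def)
      qed fact
    next
      case False
      then obtain S1 where S1: "S1 \<subseteq> S0" "card S1 = p"
        using obtain_subset_with_card_n[of p S0] by auto
      have finS1: "finite S1" using S1 S0 fin by (meson finite_subset)
      define K' where "K' = \<kappa> ` S1"
      have \<kappa>K: "\<kappa> s \<in> K" if "s \<in> S0" for s using \<kappa>(1)[OF that] by (simp add: N_def)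
      have K'K: "K' \<subseteq> K" using S1(1) \<kappa>K by (auto simp: K'_def)
      have \<kappa>adj: "(\<kappa> s, s') \<in> parcs G \<longleftrightarrow> s = s'" if "s \<in> S0" "s' \<in> S0" for s s'
        using \<kappa>[of s] that by (auto simp: N_def)
      have \<kappa>eq: "\<kappa> s = \<kappa> s' \<longleftrightarrow> s = s'" if "s \<in> S0" "s' \<in> S0" for s s'
        using \<kappa>adj that by metis
      define B where "B = pverts G - nbhd G K' - nbhd G S1"
      define T where "T = {s \<in> S. \<forall>k\<in>K'. (s, k) \<in> parcs G}"
      \<comment> \<open>Cutting down to \<open>B\<close> gives the private neighbours the
        non-adjacencies that \<open>VS3\<close> has towards \<open>VK\<close> and
        \<open>VS1\<close>.\<close>
      define M where "M t = {b \<in> B. (b, t) \<in> parcs G}" for t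
      have "finite T" using fin by (simp add: T_def)
      then obtain S2 where S2: "S2 \<subseteq> T" "(\<Union>s\<in>S2. M s) = (\<Union>s\<in>T. M s)"
        and privM: "\<forall>s\<in>S2. \<exists>x\<in>M s. \<forall>s'\<in>S2. x \<in> M s' \<longrightarrow> s' = s"
        using irredundant_subcover[of T M] by blast
      obtain \<beta> where \<beta>: "\<And>s. s \<in> S2 \<Longrightarrow> \<beta> s \<in> M s" "\<And>s s'. s \<in> S2 \<Longrightarrow> s' \<in> S2 \<Longrightarrow> \<beta> s \<in> M s' \<Longrightarrow> s' = s"
        using privM by metis
      have S2S: "S2 \<subseteq> S" using S2(1) by (auto simp: T_def)
      have "card S2 < r"
      proof (rule ccontr)
        assume "\<not> card S2 < r"
        moreover have "symp (\<lambda>u v. (\<beta> u, \<beta> v) \<in> parcs G)" using sym by (auto intro!: sympI)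
        moreover have "finite S2" using S2S fin by (rule finite_subset)
        \<comment> \<open>Ramsey's theorem is applied to \<open>S2\<close>, with two of its vertices
          related when their private neighbours are adjacent. Thus \<open>R\<close> selects matched
          pairs whose ends in \<open>B\<close> form a clique or a stable set.\<close>
        ultimately obtain R where R: "R \<subseteq> S2" "card R = q"
          "(\<forall>u\<in>R. \<forall>v\<in>R. u \<noteq> v \<longrightarrow> (\<beta> u, \<beta> v) \<in> parcs G) \<or> (\<forall>u\<in>R. \<forall>v\<in>R. u \<noteq> v \<longrightarrow> (\<beta> u, \<beta> v) \<notin> parcs G)"
          using r[of "\<lambda>u v. (\<beta> u, \<beta> v) \<in> parcs G" S2] by auto
        have "finite R" using R(1) S2S fin by (meson finite_subset)
        then obtain g where g: "bij_betw g {..<q} R"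
          using ex_bij_betw_nat_finite[of R] R(2) by (auto simp: atLeast0LessThan)
        obtain e where e: "bij_betw e {..<p} S1"
          using ex_bij_betw_nat_finite[OF finS1] S1(2) by (auto simp: atLeast0LessThan)
        have gS: "g i \<in> R" "g i \<in> S2" "g i \<in> S" if "i < q" for i
          using that g R(1) S2S by (auto simp: bij_betw_def)
        have eS: "e i \<in> S1" "e i \<in> S0" "e i \<in> S" "\<kappa> (e i) \<in> K'" "\<kappa> (e i) \<in> K" if "i < p" for i
          using that e S1(1) S0(1) K'K by (auto simp: bij_betw_def K'_def)
        have ge: "g i = g j \<longleftrightarrow> i = j" if "i < q" "j < q" for i j
          using g that by (auto simp: bij_betw_def inj_on_def)
        have ee: "e i = e j \<longleftrightarrow> i = j" if "i < p" "j < p" for i j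
          using e that by (auto simp: bij_betw_def inj_on_def)
        have \<beta>B: "\<beta> (g i) \<in> B" "(\<beta> (g i), g i) \<in> parcs G" if "i < q" for i
          using \<beta>(1)[of "g i"] gS[OF that] by (auto simp: M_def)
        show False
        proof (rule F_class_no_pattern[OF G p, of "\<lambda>i. \<kappa> (e i)" e g "\<lambda>i. \<beta> (g i)"])
          show "(\<kappa> (e i), \<kappa> (e j)) \<in> parcs G \<longleftrightarrow> i \<noteq> j" if "i < p" "j < p" for i j
            using that Kadj eS irr \<kappa>eq ee by metis
          show "(\<kappa> (e i), e j) \<in> parcs G \<longleftrightarrow> i = j" if "i < p" "j < p" for i j
            using that eS \<kappa>adj ee by metis
          show "(\<kappa> (e i), g j) \<in> parcs G" if "i < p" "j < q" for i j
            using eS(4)[OF that(1)] gS(2)[OF that(2)] S2(1) sym by (auto simp: T_def)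
          show "(\<kappa> (e i), \<beta> (g j)) \<notin> parcs G" "(e i, \<beta> (g j)) \<notin> parcs G" if "i < p" "j < q" for i j
            using eS[OF that(1)] \<beta>B[OF that(2)] sym by (auto simp: B_def nbhd_def)
          show "(g i, \<beta> (g j)) \<in> parcs G \<longleftrightarrow> i = j" if "i < q" "j < q" for i j
          proof
            assume "(g i, \<beta> (g j)) \<in> parcs G"
            then have "\<beta> (g j) \<in> M (g i)" using \<beta>B(1)[OF that(2)] sym by (auto simp: M_def)
            then show "i = j" using \<beta>(2) gS that ge by metis
          qed (use \<beta>B that sym in blast)
          show "(\<forall>i<q. \<forall>j<q. i \<noteq> j \<longrightarrow> (\<beta> (g i), \<beta> (g j)) \<in> parcs G) \<or>
              (\<forall>i<q. \<forall>j<q. i \<noteq> j \<longrightarrow> (\<beta> (g i), \<beta> (g j)) \<notin> parcs G)"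
            using R(3) gS(1) ge by metis
          show "\<kappa> (e i) \<in> pverts G" "e i \<in> pverts G" if "i < p" for i
            using eS[OF that] SV KV by auto
          show "g i \<in> pverts G" "\<beta> (g i) \<in> pverts G" if "i < q" for i
            using gS[OF that] \<beta>B[OF that] SV by (auto simp: B_def)
          show "(e i, e j) \<notin> parcs G" if "i < p" "j < p" for i j
            using eS(3) that by (intro Sadj)
          show "(e i, g j) \<notin> parcs G" if "i < p" "j < q" for i j
            using eS(3) gS(3) that by (intro Sadj)
          show "(g i, g j) \<notin> parcs G" if "i < q" "j < q" for i j
            using gS(3) that by (intro Sadj)
        qed
      qed
      show thesis
      proof (rule pattern[of K' S1 S2])
        show "K' \<subseteq> pverts G" "S1 \<subseteq> pverts G" "S2 \<subseteq> pverts G"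
          using K'K KV S1(1) S0(1) S2S SV by (meson order.trans)+
        show "card S1 \<le> p" using S1(2) by simp
        show "card K' \<le> p" using S1(2) card_image_le[OF finS1, of \<kappa>] by (simp add: K'_def)
        show "card S2 \<le> r" using \<open>card S2 < r\<close> by simp
        show "K \<subseteq> pattern_side G K' S1 S2"
        proof
          fix k assume k: "k \<in> K"
          show "k \<in> pattern_side G K' S1 S2"
          proof (cases "k \<in> K'")
            case False
            then have adj: "\<forall>k'\<in>K'. (k, k') \<in> parcs G" using Kadj k K'K by blast
            obtain s where s: "s \<in> S0" "(k, s) \<in> parcs G" using cover[OF k] by blast
            \<comment> \<open>Every vertex of \<open>K'\<close> is private to some vertex of
              \<open>S1\<close>, so it has no other neighbour in \<open>S0\<close>; stability of
              \<open>S\<close> excludes neighbours in \<open>S1\<close> and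
              \<open>S2\<close>.\<close>
            have "s \<in> pverts G - nbhd G K' - nbhd G S1 - nbhd G S2" if "s \<notin> S1"
            proof -
              have "s \<notin> nbhd G K'"
                using \<kappa>adj s(1) S1(1) that sym unfolding nbhd_def K'_def by blast
              moreover have "s \<notin> nbhd G S1" "s \<notin> nbhd G S2"
                using Sadj s(1) S0(1) S1(1) S2S unfolding nbhd_def by blast+
              ultimately show ?thesis using s(1) S0(1) SV by blast
            qed
            then have "k \<in> nbhd G S1 \<or> k \<in> nbhd G (pverts G - nbhd G K' - nbhd G S1 - nbhd G S2)"
              using s(2) k KV unfolding nbhd_def[of G S1] nbhd_def[of G "_ - _"] by blast
            then show ?thesis using adj k KV by (auto simp: pattern_side_def)
          qed (simp add: pattern_side_def)
        qed
        show "S \<inter> pattern_side G K' S1 S2 = {}"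
        proof (rule ccontr)
          assume "S \<inter> pattern_side G K' S1 S2 \<noteq> {}"
          then obtain s where s: "s \<in> S" "s \<in> pattern_side G K' S1 S2" by blast
          have "s \<notin> K'" using s(1) K'K disj by blast
          moreover have "s \<notin> nbhd G S1" using s(1) Sadj S1(1) S0(1) by (auto simp: nbhd_def)
          ultimately have "s \<in> T" "s \<in> nbhd G (B - nbhd G S2)"
            using s by (auto simp: pattern_side_def T_def B_def)
          then obtain b where b: "b \<in> B" "b \<notin> nbhd G S2" "(s, b) \<in> parcs G"
            by (auto simp: nbhd_def)
          \<comment> \<open>Here the choice of \<open>S2\<close> is used: a vertex of
            \<open>B\<close> with a neighbour in \<open>T\<close> also has one in
            \<open>S2\<close>.\<close>
          then have "b \<in> (\<Union>s\<in>T. M s)" using \<open>s \<in> T\<close> sym by (auto simp: M_def)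
          then have "b \<in> nbhd G S2"
            unfolding S2(2)[symmetric] by (auto simp: M_def B_def nbhd_def)
          with b(2) show False by simp
        qed
      qed
    qed
  qed
qed

section \<open>Counting the separations\<close>

lemma card_small_subsets_le:
  assumes "finite V" "card V \<ge> 2"
  shows "finite {T. T \<subseteq> V \<and> card T \<le> m}" "card {T. T \<subseteq> V \<and> card T \<le> m} \<le> card V ^ Suc m"
proof -
  show "finite {T. T \<subseteq> V \<and> card T \<le> m}" using assms(1) by simp
  let ?L = "{xs. set xs \<subseteq> V \<and> length xs \<le> m}"
  \<comment> \<open>Small subsets are counted through lists enumerating them, which leads to a
    geometric sum.\<close>
  have "{T. T \<subseteq> V \<and> card T \<le> m} \<subseteq> set ` ?L"
  proof
    fix T assume T: "T \<in> {T. T \<subseteq> V \<and> card T \<le> m}"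
    then have "finite T" using assms(1) by (auto intro: finite_subset)
    then obtain xs where "set xs = T" "distinct xs"
      using finite_distinct_list by metis
    with T show "T \<in> set ` ?L" by (force simp: distinct_card)
  qed
  then have "card {T. T \<subseteq> V \<and> card T \<le> m} \<le> card ?L"
    using finite_lists_length_le[OF assms(1)] by (rule surj_card_le[rotated])
  also have "\<dots> = (\<Sum>i\<le>m. card V ^ i)" using assms(1) by (rule card_lists_length_le)
  \<comment> \<open>Adding the next power at most doubles the bound, and a factor 2 is absorbed by
    \<open>card V\<close>.\<close>
  also have "\<dots> \<le> card V ^ Suc m"
  proof (induction m)
    case (Suc m)
    have "(\<Sum>i\<le>Suc m. card V ^ i) \<le> 2 * card V ^ Suc m" using Suc by simp
    also have "\<dots> \<le> card V * card V ^ Suc m" using assms(2) by (rule mult_right_mono) simp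
    finally show ?case by simp
  qed (use assms(2) in simp)
  finally show "card {T. T \<subseteq> V \<and> card T \<le> m} \<le> card V ^ Suc m" .
qed

theorem theorem1p1:
  fixes p q :: nat
  assumes "p > 0" and "q > 0"
  shows "clique_stable_separation (F_class p q :: 'a pair_pre_digraph set)"
proof -
  obtain r where r: "\<And>(A :: 'a set) Q. symp Q \<Longrightarrow> finite A \<Longrightarrow> r \<le> card A \<Longrightarrow>
      \<exists>R\<subseteq>A. card R = q \<and> ((\<forall>u\<in>R. \<forall>v\<in>R. u \<noteq> v \<longrightarrow> Q u v) \<or> (\<forall>u\<in>R. \<forall>v\<in>R. u \<noteq> v \<longrightarrow> \<not> Q u v))"
    using ramsey_symp[of q] by blast
  \<comment> \<open>One size bound for every vertex set in the last two outcomes of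
    \<open>F_class_separating_side\<close>, so that a single family \<open>F\<close> contains them
    all.\<close>
  define m where "m = max p r"
  \<comment> \<open>There are at most \<open>n ^ (3 * Suc m)\<close> triples of small sets, where
    \<open>n\<close> is the number of vertices. The other two families of sides obey the same bound,
    and the resulting factor 3 is at most \<open>n ^ 2\<close>.\<close>
  have "\<exists>P. finite P \<and> card P \<le> card (pverts G) ^ (3 * Suc m + 2) \<and>
        (\<forall>(X, Y)\<in>P. X \<union> Y = pverts G \<and> X \<inter> Y = {}) \<and>
        (\<forall>K S. Defs.clique G K \<and> stable_set G S \<and> K \<inter> S = {} \<longrightarrow> (\<exists>(X, Y)\<in>P. K \<subseteq> X \<and> S \<subseteq> Y))"
    if G: "G \<in> F_class p q" and n2: "card (pverts G) \<ge> 2" for G :: "'a pair_pre_digraph"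
  proof -
    interpret pair_graph G using G by (simp add: F_class_def)
    let ?n = "card (pverts G)"
    define F where "F = {T. T \<subseteq> pverts G \<and> card T \<le> m}"
    have finF: "finite F" and cardF: "card F \<le> ?n ^ Suc m"
      using card_small_subsets_le[OF finite_verts n2] by (simp_all add: F_def)
    define Xs where "Xs = (\<lambda>k. insert k (nbhd G {k})) ` pverts G \<union> nbhd G ` F \<union>
      (\<lambda>(K', S1, S2). pattern_side G K' S1 S2) ` (F \<times> F \<times> F)"
    define P where "P = (\<lambda>X. (X, pverts G - X)) ` Xs"
    have finX: "finite Xs" unfolding Xs_def using finF by auto
    have "card (F \<times> F \<times> F) \<le> ?n ^ Suc m * (?n ^ Suc m * ?n ^ Suc m)"
      unfolding card_cartesian_product using cardF by (intro mult_mono) auto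
    also have "\<dots> = (?n ^ Suc m) ^ 3" by (simp only: power3_eq_cube mult.assoc)
    also have "\<dots> = ?n ^ (3 * Suc m)" by (simp only: power_mult[symmetric] mult.commute)
    finally have c3: "card (F \<times> F \<times> F) \<le> ?n ^ (3 * Suc m)" .
    have "card P \<le> card Xs" unfolding P_def using finX by (rule card_image_le)
    also have "\<dots> \<le> ?n + card F + card (F \<times> F \<times> F)"
      unfolding Xs_def
      by (intro order.trans[OF card_Un_le] add_mono card_image_le) (use finF in auto)
    also have "\<dots> \<le> ?n ^ (3 * Suc m) + ?n ^ (3 * Suc m) + ?n ^ (3 * Suc m)"
    proof (intro add_mono c3)
      show "?n \<le> ?n ^ (3 * Suc m)" using n2 by (intro self_le_power) auto
      show "card F \<le> ?n ^ (3 * Suc m)"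
        using n2 by (intro order.trans[OF cardF] power_increasing) auto
    qed
    also have "\<dots> \<le> 2 ^ 2 * ?n ^ (3 * Suc m)" by simp
    also have "\<dots> \<le> ?n ^ 2 * ?n ^ (3 * Suc m)" using n2 by (intro mult_right_mono power_mono) auto
    also have "\<dots> = ?n ^ (3 * Suc m + 2)" by (simp only: power_add mult.commute)
    finally have "card P \<le> ?n ^ (3 * Suc m + 2)" .
    moreover have "finite P" using finX by (simp add: P_def)
    moreover have "X \<subseteq> pverts G" if "X \<in> Xs" for X
      using that by (auto simp: Xs_def F_def nbhd_def pattern_side_def)
    then have "\<forall>(X, Y)\<in>P. X \<union> Y = pverts G \<and> X \<inter> Y = {}"
      by (auto simp: P_def)
    moreover have "\<exists>(X, Y)\<in>P. K \<subseteq> X \<and> S \<subseteq> Y"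
      if KS: "Defs.clique G K" "stable_set G S" "K \<inter> S = {}" for K S
    proof -
      have "\<exists>X\<in>Xs. K \<subseteq> X \<and> S \<inter> X = {}"
      proof (rule F_class_separating_side[OF G \<open>p > 0\<close> r KS])
        fix k assume "k \<in> pverts G" "K \<subseteq> insert k (nbhd G {k})" "S \<inter> insert k (nbhd G {k}) = {}"
        then show ?thesis unfolding Xs_def by blast
      next
        fix T assume T: "T \<subseteq> pverts G" "card T \<le> p" "K \<subseteq> nbhd G T" "S \<inter> nbhd G T = {}"
        then have "T \<in> F" by (simp add: F_def m_def)
        then show ?thesis using T unfolding Xs_def by blast
      next
        fix K' S1 S2
        assume *: "K' \<subseteq> pverts G" "S1 \<subseteq> pverts G" "S2 \<subseteq> pverts G"
          "card K' \<le> p" "card S1 \<le> p" "card S2 \<le> r"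
          and sep: "K \<subseteq> pattern_side G K' S1 S2" "S \<inter> pattern_side G K' S1 S2 = {}"
        from * have "(K', S1, S2) \<in> F \<times> F \<times> F" by (auto simp: F_def m_def)
        then have "pattern_side G K' S1 S2 \<in> Xs" unfolding Xs_def by force
        then show ?thesis using sep by blast
      qed
      moreover have "S \<subseteq> pverts G" using KS(2) by (simp add: stable_set_def)
      ultimately show ?thesis by (auto simp: P_def)
    qed
    ultimately show ?thesis by (intro exI[of _ P]) simp
  qed
  then show ?thesis
    unfolding clique_stable_separation_def
    by (intro conjI hereditary_F_class exI[of _ "3 * Suc m + 2"] ballI impI)
qed

end
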